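(* Let $H$ be a separable complex Hilbert space with scalar product $\langle\cdot,\cdot\rangle$ and norm $\|\cdot\|$. Let $L\colon \operatorname{Dom}(L)\subset H\to H$ be a densely defined self-adjoint (in general unbounded) linear operator with spectrum $\sigma(L)$ and resolvent set $\rho(L)$, and let $\delta>0$, $\gamma\ge 0$ be constants such that (L1) $0\in\sigma(L)$; (L2) $(-\delta,0)\subset\rho(L)$; (L3) $\inf\sigma(L)\ge-\gamma$. Let $h\in H\setminus\{0\}$ and let $N\colon H\to H$ be a (nonlinear) operator that is bounded, demicontinuous, satisfies $N(0)=0$, and is such that (i) there exists $\alpha>\gamma/\delta^2$ such that for all $u_1,u_2\in H$ $$\operatorname{Re}\langle N(u_1)-N(u_2),u_1-u_2\rangle\ge\alpha\|N(u_1)-N(u_2)\|^2;$$ (ii) with this $\alpha$, $\displaystyle\limsup_{k\to+\infty}\frac{\operatorname{Re}\langle N(u_k),u_k\rangle}{\|u_k\|}>\frac{\gamma\|h\|}{\delta^2\alpha-\gamma}$ for each sequence $\{u_k\}_{k\in\mathbb N}\subset H$ such that $\|u_k\|\to+\infty$; (iii) $\displaystyle J_N(u)>\frac{\gamma\|h\|}{\delta^2\alpha-\gamma}+\operatorname{Re}\langle h,u\rangle$ for all $u\in\operatorname{Ker}L\setminus\{0\}$. Then the equation $Lu+N(u)=h$ has a solution $u\in\operatorname{Dom}(L)$.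
   Context: An operator $N\colon H\to H$ is called bounded if the image of every bounded subset of $H$ is bounded, and demicontinuous if $u_k\to u_0$ in norm implies $N(u_k)\rightharpoonup N(u_0)$ weakly in $H$. The recession functional $J_N\colon H\to[-\infty,+\infty]$ is defined by $$J_N(u)=\inf\Big\{\liminf_{k\to+\infty}\operatorname{Re}\langle N(t_kv_k),v_k\rangle:\ t_k\to+\infty,\ \{v_k\}_{k\in\mathbb N}\subset H,\ v_k\rightharpoonup u\Big\},$$ where $\{t_k\}$ is a real sequence and $\rightharpoonup$ denotes weak convergence in $H$. *)

theory Defs
  imports "HOL-Analysis.Analysis"
begin

section \<open>Complex Hilbert spaces\<close>

class complex_vector = real_vector +
  fixes scaleC :: "complex \<Rightarrow> 'a \<Rightarrow> 'a"  (infixr "*\<^sub>C" 75)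
  assumes scaleC_add_right: "a *\<^sub>C (x + y) = a *\<^sub>C x + a *\<^sub>C y"
    and scaleC_add_left: "(a + b) *\<^sub>C x = a *\<^sub>C x + b *\<^sub>C x"
    and scaleC_scaleC: "a *\<^sub>C b *\<^sub>C x = (a * b) *\<^sub>C x"
    and scaleC_one: "1 *\<^sub>C x = x"
    and scaleR_scaleC: "r *\<^sub>R x = complex_of_real r *\<^sub>C x"

interpretation complex_vector: vector_space "scaleC :: complex \<Rightarrow> 'a \<Rightarrow> 'a::complex_vector"
  by standard (simp_all add: scaleC_add_right scaleC_add_left scaleC_scaleC scaleC_one)

text \<open>The inner product is linear in its first and conjugate linear in its second argument.\<close>

class complex_inner = complex_vector + real_normed_vector +
  fixes cinner :: "'a \<Rightarrow> 'a \<Rightarrow> complex"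
  assumes cinner_commute: "cinner x y = cnj (cinner y x)"
    and cinner_add_left: "cinner (x + y) z = cinner x z + cinner y z"
    and cinner_scaleC_left: "cinner (a *\<^sub>C x) y = a * cinner x y"
    and cinner_ge_zero: "0 \<le> Re (cinner x x)"
    and cinner_eq_zero_iff: "cinner x x = 0 \<longleftrightarrow> x = 0"
    and norm_eq_sqrt_cinner: "norm x = sqrt (Re (cinner x x))"

class complex_hilbert_space = complex_inner + complete_space

instantiation complex :: complex_hilbert_space
begin

definition scaleC_complex :: "complex \<Rightarrow> complex \<Rightarrow> complex"
  where "scaleC_complex a x = a * x"

definition cinner_complex :: "complex \<Rightarrow> complex \<Rightarrow> complex"
  where "cinner_complex x y = x * cnj y"

instance
  by standard
    (simp_all add: scaleC_complex_def cinner_complex_def algebra_simps scaleR_conv_of_real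
      cmod_def power2_eq_square)

end

definition weakly_tendsto :: "(nat \<Rightarrow> 'a::complex_inner) \<Rightarrow> 'a \<Rightarrow> bool"
  where "weakly_tendsto x l \<longleftrightarrow> (\<forall>w. (\<lambda>k. cinner (x k) w) \<longlonglongrightarrow> cinner l w)"


section \<open>Unbounded linear operators\<close>

text \<open>
  An unbounded operator is given by its domain D and a function L; the values of L outside D
  are irrelevant.
\<close>

definition linear_operator :: "'a::complex_vector set \<Rightarrow> ('a \<Rightarrow> 'a) \<Rightarrow> bool"
  where "linear_operator D L \<longleftrightarrow>
    complex_vector.subspace D \<and>
    (\<forall>u\<in>D. \<forall>v\<in>D. L (u + v) = L u + L v) \<and>
    (\<forall>c. \<forall>u\<in>D. L (c *\<^sub>C u) = c *\<^sub>C L u)"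

definition densely_defined :: "'a::topological_space set \<Rightarrow> bool"
  where "densely_defined D \<longleftrightarrow> closure D = UNIV"

definition op_kernel :: "'a::zero set \<Rightarrow> ('a \<Rightarrow> 'a) \<Rightarrow> 'a set"
  where "op_kernel D L = {u \<in> D. L u = 0}"

definition adjoint_dom :: "'a::complex_inner set \<Rightarrow> ('a \<Rightarrow> 'a) \<Rightarrow> 'a set"
  where "adjoint_dom D L = {v. \<exists>w. \<forall>u\<in>D. cinner (L u) v = cinner u w}"

text \<open>The vector w below is unique when D is dense.\<close>

definition adjoint_op :: "'a::complex_inner set \<Rightarrow> ('a \<Rightarrow> 'a) \<Rightarrow> 'a \<Rightarrow> 'a"
  where "adjoint_op D L v = (THE w. \<forall>u\<in>D. cinner (L u) v = cinner u w)"

definition self_adjoint :: "'a::complex_inner set \<Rightarrow> ('a \<Rightarrow> 'a) \<Rightarrow> bool"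
  where "self_adjoint D L \<longleftrightarrow>
    linear_operator D L \<and> densely_defined D \<and>
    adjoint_dom D L = D \<and> (\<forall>v\<in>D. adjoint_op D L v = L v)"

text \<open>
  The inverse is automatically complex linear, so \<^const>\<open>bounded_linear\<close>, which speaks about
  real scalars, only adds its boundedness.
\<close>

definition resolvent_set :: "'a::complex_inner set \<Rightarrow> ('a \<Rightarrow> 'a) \<Rightarrow> complex set"
  where "resolvent_set D L =
    {z. bij_betw (\<lambda>u. L u - z *\<^sub>C u) D UNIV \<and>
        bounded_linear (inv_into D (\<lambda>u. L u - z *\<^sub>C u))}"

definition spectrum :: "'a::complex_inner set \<Rightarrow> ('a \<Rightarrow> 'a) \<Rightarrow> complex set"
  where "spectrum D L = - resolvent_set D L"

text \<open>
  For a self-adjoint operator the spectrum is real, so no part of it is lost here.  The infimum is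
  taken in the extended reals, where it is meaningful also if the spectrum is unbounded below.
\<close>

definition inf_spectrum :: "'a::complex_inner set \<Rightarrow> ('a \<Rightarrow> 'a) \<Rightarrow> ereal"
  where "inf_spectrum D L = (INF x\<in>{x::real. complex_of_real x \<in> spectrum D L}. ereal x)"


section \<open>Nonlinear operators\<close>

definition bounded_operator :: "('a::metric_space \<Rightarrow> 'a) \<Rightarrow> bool"
  where "bounded_operator N \<longleftrightarrow> (\<forall>S. bounded S \<longrightarrow> bounded (N ` S))"

definition demicontinuous :: "('a::complex_inner \<Rightarrow> 'a) \<Rightarrow> bool"
  where "demicontinuous N \<longleftrightarrow>
    (\<forall>u u0. u \<longlonglongrightarrow> u0 \<longrightarrow> weakly_tendsto (\<lambda>k. N (u k)) (N u0))"

definition recession_functional :: "('a::complex_inner \<Rightarrow> 'a) \<Rightarrow> 'a \<Rightarrow> ereal"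
  where "recession_functional N u =
    Inf {liminf (\<lambda>k. ereal (Re (cinner (N (t k *\<^sub>R v k)) (v k)))) | (t :: nat \<Rightarrow> real) v.
      filterlim t at_top sequentially \<and> weakly_tendsto v u}"

end

theory Submission
  imports Defs "HOL-Complex_Analysis.Great_Picard"
begin

text \<open>
  With \<open>\<mu> = 1/(2\<alpha>)\<close> the equation is a fixed point problem for the nonexpansive mapping
  \<open>T u = (L + \<mu>)\<^sup>-\<^sup>1 (h + \<mu> u - N u)\<close>: cocoercivity makes \<open>\<mu> - N\<close> Lipschitz with constant \<open>\<mu>\<close>, and the
  spectral gap gives \<open>Re \<langle>L u, u\<rangle> \<ge> - \<beta> \<parallel>L u\<parallel>\<^sup>2\<close> with \<open>\<beta> = \<gamma>/\<delta>\<^sup>2 < \<alpha>\<close>, hence \<open>\<parallel>(L + \<mu>)\<^sup>-\<^sup>1\<parallel> \<le> 1/\<mu>\<close>.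
  If T had no fixed point, the solutions of \<open>T u\<^sub>n = (1 + \<eta>\<^sub>n) u\<^sub>n\<close> with \<open>\<eta>\<^sub>n\<close> tending to 0 would be
  unbounded.  A weak limit w of a subsequence of \<open>u\<^sub>n / \<parallel>u\<^sub>n\<parallel>\<close> then lies in the kernel of L, and testing
  the equation with \<open>u\<^sub>n\<close> shows that \<open>Re \<langle>N u\<^sub>n, u\<^sub>n\<rangle> / \<parallel>u\<^sub>n\<parallel>\<close> has upper limit at most
  \<open>\<alpha>/(\<alpha> - \<beta>) Re \<langle>h, w\<rangle>\<close>.  This contradicts (ii) if \<open>w = 0\<close> and (iii) otherwise.
\<close>

section \<open>The real part of the scalar product\<close>

text \<open>The scalar product of H regarded as a real Hilbert space. It induces the same norm, and
  all estimates below are about real parts.\<close>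

definition rinner :: "'a::complex_inner \<Rightarrow> 'a \<Rightarrow> real"
  where "rinner x y = Re (cinner x y)"

lemma rinner_commute: "rinner x y = rinner y x"
  unfolding rinner_def by (subst cinner_commute) simp

lemma rinner_add_left: "rinner (x + y) z = rinner x z + rinner y z"
  by (simp add: rinner_def cinner_add_left)

lemma rinner_scaleR_left: "rinner (r *\<^sub>R x) y = r * rinner x y"
  by (simp add: rinner_def scaleR_scaleC cinner_scaleC_left)

lemma rinner_add_right: "rinner x (y + z) = rinner x y + rinner x z"
  by (metis rinner_add_left rinner_commute)

lemma rinner_scaleR_right: "rinner x (r *\<^sub>R y) = r * rinner x y"
  by (metis rinner_scaleR_left rinner_commute)

lemma rinner_self: "rinner x x = (norm x)\<^sup>2"
  by (simp add: rinner_def norm_eq_sqrt_cinner cinner_ge_zero)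

lemma norm_add_sq: "(norm (x + y))\<^sup>2 = (norm x)\<^sup>2 + 2 * rinner x y + (norm y)\<^sup>2"
  for x y :: "'a::complex_inner"
  by (simp add: rinner_self[symmetric] rinner_add_left rinner_add_right rinner_commute)

text \<open>Cauchy-Schwarz comes from squaring the triangle inequality, which the class already
  supplies; x and -x give the two signs.\<close>

lemma abs_rinner_le: "\<bar>rinner x y\<bar> \<le> norm x * norm y"
proof -
  have "(2 * rinner x y) \<le> 2 * (norm x * norm y)" for x y :: 'a
  proof -
    have "(norm (x + y))\<^sup>2 \<le> (norm x + norm y)\<^sup>2"
      by (intro power_mono norm_triangle_ineq) simp
    then show ?thesis
      unfolding norm_add_sq by (simp add: power2_sum)
  qed
  from this[of x y] this[of "-x" y] show ?thesis
    using rinner_scaleR_left[of "-1" x y] by simp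
qed

interpretation rinner: bounded_bilinear rinner
proof
  show "\<exists>K. \<forall>a b. norm (rinner a b) \<le> norm a * norm b * K"
    using abs_rinner_le by (intro exI[of _ 1]) auto
qed (simp_all add: rinner_add_left rinner_add_right rinner_scaleR_left rinner_scaleR_right)

lemma norm_diff_sq: "(norm (x - y))\<^sup>2 = (norm x)\<^sup>2 - 2 * rinner x y + (norm y)\<^sup>2"
  for x y :: "'a::complex_inner"
  using norm_add_sq[of x "-y"] by (simp add: rinner.minus_right)

lemma cinner_scaleC_right: "cinner x (a *\<^sub>C y) = cnj a * cinner x y"
  by (metis cinner_commute cinner_scaleC_left complex_cnj_mult)

text \<open>The imaginary part is a real part tested with \<open>\<i> *\<^sub>C y\<close>, so weak
  convergence can be checked on \<open>rinner\<close> alone.\<close>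

lemma cinner_eq_rinner: "cinner x y = Complex (rinner x y) (rinner x (\<i> *\<^sub>C y))"
  by (rule complex_eqI) (simp_all add: rinner_def cinner_scaleC_right)

lemma cinner_zero_right: "cinner x 0 = 0"
  using cinner_scaleC_right[of x 0 0] by simp

lemma tendsto_cinner_right:
  assumes "(f \<longlongrightarrow> l) F"
  shows "((\<lambda>k. cinner x (f k)) \<longlongrightarrow> cinner x l) F"
proof -
  have *: "cinner x y = Complex (rinner x y) (- rinner (\<i> *\<^sub>C x) y)" for y
    by (rule complex_eqI) (simp_all add: rinner_def cinner_scaleC_left)
  show ?thesis
    unfolding * by (intro tendsto_Complex tendsto_minus rinner.tendsto tendsto_const assms)
qed

lemma weakly_tendsto_iff_rinner:
  "weakly_tendsto x l \<longleftrightarrow> (\<forall>w. (\<lambda>k. rinner (x k) w) \<longlonglongrightarrow> rinner l w)"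
proof
  assume "weakly_tendsto x l"
  then show "\<forall>w. (\<lambda>k. rinner (x k) w) \<longlonglongrightarrow> rinner l w"
    unfolding weakly_tendsto_def rinner_def by (auto intro: tendsto_Re)
next
  assume "\<forall>w. (\<lambda>k. rinner (x k) w) \<longlonglongrightarrow> rinner l w"
  then show "weakly_tendsto x l"
    unfolding weakly_tendsto_def cinner_eq_rinner by (auto intro: tendsto_Complex)
qed

lemma eq_zero_if_orthogonal_dense:
  fixes w :: "'a::complex_inner"
  assumes "closure D = UNIV" and "\<And>u. u \<in> D \<Longrightarrow> rinner u w = 0"
  shows "w = 0"
proof -
  have "w \<in> closure D"
    using assms(1) by simp
  then obtain x where x: "\<And>n. x n \<in> D" "x \<longlonglongrightarrow> w"
    unfolding closure_sequential by blast
  from x(2) have "(\<lambda>n. rinner (x n) w) \<longlonglongrightarrow> rinner w w"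
    by (intro rinner.tendsto tendsto_const)
  then have "rinner w w = 0"
    using assms(2)[OF x(1)] by (simp add: LIMSEQ_const_iff)
  then show ?thesis
    by (simp add: rinner_self)
qed

section \<open>Weak sequential compactness\<close>

text \<open>Direct method: the energy \<open>J\<close> has a minimiser v, whose Euler equation is
  the representation. The parallelogram identity makes a minimising sequence Cauchy.\<close>

lemma riesz_representation:
  fixes g :: "'a::complex_hilbert_space \<Rightarrow> real"
  assumes "bounded_linear g"
  obtains v where "\<And>w. g w = rinner v w"
proof -
  interpret g: bounded_linear g by fact
  define J where "J w = (norm w)\<^sup>2 / 2 - g w" for w
  obtain K where K: "\<And>w. \<bar>g w\<bar> \<le> norm w * K"
    using g.bounded by auto
  have "- K\<^sup>2 / 2 \<le> J w" for w
  proof -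
    have "0 \<le> (norm w - K)\<^sup>2" by simp
    also have "\<dots> = (norm w)\<^sup>2 - 2 * (norm w * K) + K\<^sup>2"
      by (simp add: power2_diff)
    finally show ?thesis
      using K[of w] by (simp add: J_def)
  qed
  then have bdd: "bdd_below (range J)"
    by (intro bdd_belowI) blast
  define I where "I = Inf (range J)"
  have I_le: "I \<le> J w" for w
    unfolding I_def using bdd by (intro cInf_lower) auto
  have "\<exists>w. J w < I + 1 / Suc n" for n
  proof -
    have "I < I + 1 / Suc n" by simp
    then show ?thesis
      unfolding I_def using cInf_lessD[of "range J"] by blast
  qed
  then obtain w where w: "\<And>n. J (w n) < I + 1 / Suc n"
    by metis
  have arith: "4 * (a + b - 2 * c) < e" if "a < I + e / 8" "b < I + e / 8" "I \<le> c"
    for a b c e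
    using that by argo
  \<comment> \<open>The linear part g cancels here. Two values less than e^2/8 above the infimum,
    with a midpoint value at least \<open>I\<close>, are therefore at distance below e.\<close>
  have para: "(norm (x - y))\<^sup>2 = 4 * (J x + J y - 2 * J ((1/2) *\<^sub>R (x + y)))" for x y
    by (simp add: J_def norm_add_sq norm_diff_sq power_mult_distrib g.add g.scaleR
        rinner_scaleR_left rinner_scaleR_right power2_eq_square[of 2] field_simps)
  have "Cauchy w"
  proof (rule metric_CauchyI)
    fix e :: real
    assume "0 < e"
    then have "0 < e\<^sup>2 / 8" by simp
    then obtain M where M: "1 / real (Suc M) < e\<^sup>2 / 8"
      by (metis nat_approx_posE)
    show "\<exists>M. \<forall>m\<ge>M. \<forall>n\<ge>M. dist (w m) (w n) < e"
    proof (intro exI allI impI)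
      fix m n
      assume "M \<le> m" "M \<le> n"
      then have "1 / real (Suc m) \<le> 1 / Suc M" "1 / real (Suc n) \<le> 1 / Suc M"
        by (simp_all add: field_simps)
      then have "J (w m) < I + e\<^sup>2 / 8" "J (w n) < I + e\<^sup>2 / 8"
        using M w[of m] w[of n] by linarith+
      then have "(norm (w m - w n))\<^sup>2 < e\<^sup>2"
        unfolding para by (intro arith I_le)
      then show "dist (w m) (w n) < e"
        unfolding dist_norm using \<open>0 < e\<close> by (simp add: power_less_imp_less_base)
    qed
  qed
  then obtain v where v: "w \<longlonglongrightarrow> v"
    using Cauchy_convergent_iff convergent_def by blast
  have "(\<lambda>n. J (w n)) \<longlonglongrightarrow> J v"
    unfolding J_def by (intro tendsto_intros g.tendsto v) simp
  moreover have "(\<lambda>n. I + 1 / Suc n) \<longlonglongrightarrow> I"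
    using LIMSEQ_inverse_real_of_nat_add[of I] by (simp add: divide_inverse)
  ultimately have "J v \<le> I"
    by (rule LIMSEQ_le) (use w in \<open>auto intro: less_imp_le\<close>)
  have "g x = rinner v x" for x
  proof -
    \<comment> \<open>\<open>c\<close> is the derivative of \<open>J\<close> at v in direction x.
      Minimality on this line gives \<open>ineq\<close>, whose right-hand side is smallest at t =
      -c/|x|^2.\<close>
    define c where "c = rinner v x - g x"
    have ineq: "0 \<le> t * c + t\<^sup>2 * (norm x)\<^sup>2 / 2" for t
      using \<open>J v \<le> I\<close> I_le[of "v + t *\<^sub>R x"]
      by (simp add: J_def c_def norm_add_sq power_mult_distrib g.add g.scaleR
          rinner_scaleR_right algebra_simps)
    have "c = 0"
    proof (cases "x = 0")
      case True
      then show ?thesis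
        by (simp add: c_def g.zero rinner.zero_right)
    next
      case False
      then have n: "norm x > 0" by simp
      have "0 \<le> - (c\<^sup>2) / (2 * (norm x)\<^sup>2)"
        using ineq[of "- c / (norm x)\<^sup>2"] n
        by (simp add: power_divide power2_eq_square field_simps)
      then show ?thesis
        using n by (simp add: divide_le_0_iff zero_le_divide_iff)
    qed
    then show ?thesis by (simp add: c_def)
  qed
  then show thesis by (rule that)
qed

text \<open>Diagonal selection on a countable dense set, extension to all x by the uniform bound,
  then Riesz for the limit functional.\<close>

lemma weakly_convergent_subsequence:
  fixes v :: "nat \<Rightarrow> 'a::complex_hilbert_space"
  assumes sep: "separable_space (euclidean :: 'a topology)"
    and bound: "\<And>k. norm (v k) \<le> M"
  obtains r l where "strict_mono (r :: nat \<Rightarrow> nat)" and "weakly_tendsto (v \<circ> r) l"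
proof -
  obtain C :: "'a set" where C: "countable C" "closure C = UNIV"
    using sep unfolding separable_space_def by auto
  have M: "0 \<le> M"
    using bound[of 0] norm_ge_zero order_trans by blast
  have le: "\<bar>rinner (v k) x\<bar> \<le> M * norm x" for k x
    using abs_rinner_le[of "v k" x] mult_right_mono[OF bound[of k] norm_ge_zero[of x]] by linarith
  \<comment> \<open>Dividing by |x| makes the bound uniform in x too, as the diagonal selection
    requires; for x = 0 the quotient is 0.\<close>
  have "norm (rinner (v k) x / norm x) \<le> M" for k x
    using le[of k x] M by (cases "x = 0") (simp_all add: divide_le_eq)
  then obtain r where r: "strict_mono (r :: nat \<Rightarrow> nat)"
    and conv: "\<forall>x\<in>C. \<exists>l. (\<lambda>n. rinner (v (r n)) x / norm x) \<longlonglongrightarrow> l"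
    by (rule function_convergent_subsequence
        [OF C(1), where f = "\<lambda>k x. rinner (v k) x / norm x" and M = M]) blast
  have convC: "convergent (\<lambda>n. rinner (v (r n)) x)" if x: "x \<in> C" for x
  proof (cases "x = 0")
    case True
    then show ?thesis by (simp add: rinner.zero_right convergent_const)
  next
    case False
    obtain l where "(\<lambda>n. rinner (v (r n)) x / norm x) \<longlonglongrightarrow> l"
      using conv x by blast
    then have "(\<lambda>n. rinner (v (r n)) x / norm x * norm x) \<longlonglongrightarrow> l * norm x"
      by (intro tendsto_intros)
    then show ?thesis
      using False by (auto simp: convergent_def)
  qed
  have "convergent (\<lambda>n. rinner (v (r n)) x)" for x
  proof -
    have "Cauchy (\<lambda>n. rinner (v (r n)) x)"
    proof (rule metric_CauchyI)
      fix e :: real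
      assume e: "0 < e"
      \<comment> \<open>Half of e goes to the Cauchy property at c, a quarter to each replacement of
        x by c; M + 1 keeps the denominator positive when M = 0.\<close>
      define d where "d = e / (4 * (M + 1))"
      have d: "d > 0" "M * d \<le> e / 4"
        using e M by (simp_all add: d_def field_simps)
      obtain c where c: "c \<in> C" "dist c x < d"
        using C(2) d(1) closure_approachable[of x C] by auto
      have near: "\<bar>rinner (v k) x - rinner (v k) c\<bar> \<le> e / 4" for k
      proof -
        have "\<bar>rinner (v k) x - rinner (v k) c\<bar> \<le> M * norm (x - c)"
          using le[of k "x - c"] by (simp add: rinner.diff_right)
        also have "\<dots> \<le> M * d"
          using c(2) M by (intro mult_left_mono) (simp_all add: dist_norm norm_minus_commute)
        finally show ?thesis using d(2) by linarith
      qed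
      have "Cauchy (\<lambda>n. rinner (v (r n)) c)"
        using convC[OF c(1)] by (simp add: Cauchy_convergent_iff)
      from metric_CauchyD[OF this, of "e / 2"] e
      obtain K where K: "\<And>m n. K \<le> m \<Longrightarrow> K \<le> n \<Longrightarrow>
          \<bar>rinner (v (r m)) c - rinner (v (r n)) c\<bar> < e / 2"
        by (auto simp: dist_real_def)
      show "\<exists>K. \<forall>m\<ge>K. \<forall>n\<ge>K. dist (rinner (v (r m)) x) (rinner (v (r n)) x) < e"
      proof (intro exI allI impI)
        fix m n
        assume "K \<le> m" "K \<le> n"
        then show "dist (rinner (v (r m)) x) (rinner (v (r n)) x) < e"
          using K[of m n] near[of "r m"] near[of "r n"] unfolding dist_real_def by linarith
      qed
    qed
    then show ?thesis by (simp add: Cauchy_convergent_iff)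
  qed
  then obtain g where g: "\<And>x. (\<lambda>n. rinner (v (r n)) x) \<longlonglongrightarrow> g x"
    unfolding convergent_def by metis
  have "bounded_linear g"
  proof (rule bounded_linear_intro)
    show "g (x + y) = g x + g y" for x y
      using tendsto_add[OF g[of x] g[of y]] g[of "x + y"]
      by (simp add: rinner_add_right LIMSEQ_unique)
    show "g (c *\<^sub>R x) = c *\<^sub>R g x" for c x
      using tendsto_mult_left[OF g[of x], of c] g[of "c *\<^sub>R x"]
      by (simp add: rinner_scaleR_right LIMSEQ_unique)
    show "norm (g x) \<le> norm x * M" for x
      using tendsto_norm[OF g[of x]] le
      by (intro LIMSEQ_le_const2) (auto simp: mult.commute)
  qed
  then obtain l where l: "\<And>x. g x = rinner l x"
    using riesz_representation[of g] by metis
  have "weakly_tendsto (v \<circ> r) l"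
    unfolding weakly_tendsto_iff_rinner o_def l[symmetric] using g ..
  with r show thesis by (rule that)
qed

section \<open>Nonexpansive mappings\<close>

text \<open>
  Since the identity minus T is monotone, the solutions of T u = (1 + \<eta>) u satisfy
  \<open>\<parallel>u' - u\<parallel>\<^sup>2 \<le> \<parallel>u'\<parallel>\<^sup>2 - \<parallel>u\<parallel>\<^sup>2\<close> for \<open>\<eta>' < \<eta>\<close>.  Hence they converge if they stay bounded.
\<close>

lemma nonexpansive_no_fixpoint:
  fixes T :: "'a::complex_hilbert_space \<Rightarrow> 'a"
  assumes nonexp: "\<And>x y. norm (T x - T y) \<le> norm (x - y)"
    and no_fix: "\<And>x. T x \<noteq> x"
  obtains u where "\<And>n. T (u n) = (1 + 1 / real (Suc n)) *\<^sub>R u n"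
    and "filterlim (\<lambda>n. norm (u n)) at_top sequentially"
proof -
  define \<eta> where "\<eta> n = 1 / real (Suc n)" for n
  have \<eta>_pos: "\<eta> n > 0" for n by (simp add: \<eta>_def)
  have "\<exists>x. T x = (1 + \<eta> n) *\<^sub>R x" for n
  proof -
    have "\<exists>!x. x \<in> UNIV \<and> (1 / (1 + \<eta> n)) *\<^sub>R T x = x"
    proof (rule Banach_fix)
      show "0 \<le> 1 / (1 + \<eta> n)" "1 / (1 + \<eta> n) < 1"
        using \<eta>_pos[of n] by simp_all
      show "dist ((1 / (1 + \<eta> n)) *\<^sub>R T x) ((1 / (1 + \<eta> n)) *\<^sub>R T y) \<le> 1 / (1 + \<eta> n) * dist x y"
        for x y
        using nonexp[of x y] \<eta>_pos[of n]
        by (simp add: dist_norm divide_right_mono flip: scaleR_diff_right)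
    qed (simp_all add: complete_UNIV)
    then obtain x where "(1 / (1 + \<eta> n)) *\<^sub>R T x = x" by blast
    then have "(1 + \<eta> n) *\<^sub>R ((1 / (1 + \<eta> n)) *\<^sub>R T x) = (1 + \<eta> n) *\<^sub>R x" by simp
    then have "T x = (1 + \<eta> n) *\<^sub>R x"
      using \<eta>_pos[of n] by simp
    then show ?thesis by blast
  qed
  then obtain u where u: "\<And>n. T (u n) = (1 + \<eta> n) *\<^sub>R u n"
    by metis
  have dist_le: "(norm (u j - u k))\<^sup>2 \<le> (norm (u j))\<^sup>2 - (norm (u k))\<^sup>2" if "k < j" for k j
  proof -
    define a b c where "a = (norm (u k))\<^sup>2" and "b = (norm (u j))\<^sup>2" and "c = rinner (u k) (u j)"
    have \<eta>: "\<eta> j < \<eta> k"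
      using that by (simp add: \<eta>_def field_simps)
    \<comment> \<open>Monotonicity of the identity minus T, tested on u_k - u_j; inserting T u = (1
      + \<eta>) u leaves only the terms with \<eta>.\<close>
    have "rinner (T (u k) - T (u j)) (u k - u j) \<le> norm (T (u k) - T (u j)) * norm (u k - u j)"
      using abs_rinner_le abs_le_D1 by blast
    also have "\<dots> \<le> rinner (u k - u j) (u k - u j)"
      unfolding rinner_self power2_eq_square by (intro mult_right_mono nonexp) simp
    finally have "\<eta> k * a + \<eta> j * b \<le> (\<eta> k + \<eta> j) * c"
      unfolding u a_def b_def c_def
      by (simp add: rinner.diff_left rinner.diff_right rinner_add_left rinner_scaleR_left
          rinner_self norm_diff_sq rinner_commute[of "u j" "u k"] algebra_simps)
    then have "(\<eta> k + \<eta> j) * (a + b - 2 * c) \<le> (\<eta> k - \<eta> j) * (b - a)"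
      by (simp add: algebra_simps)
    moreover have ns: "(norm (u j - u k))\<^sup>2 = a + b - 2 * c"
      by (simp add: a_def b_def c_def norm_diff_sq rinner_commute)
    ultimately have *: "(\<eta> k + \<eta> j) * (norm (u j - u k))\<^sup>2 \<le> (\<eta> k - \<eta> j) * (b - a)"
      by simp
    moreover have "0 \<le> (\<eta> k + \<eta> j) * (norm (u j - u k))\<^sup>2"
      using \<eta>_pos[of k] \<eta>_pos[of j] by simp
    ultimately have "0 \<le> b - a"
      using \<eta> by (smt (verit) mult_pos_neg)
    \<comment> \<open>As b - a is nonnegative, its factor may be enlarged to
      \<open>\<eta> k + \<eta> j\<close> and then cancelled.\<close>
    then have "(\<eta> k - \<eta> j) * (b - a) \<le> (\<eta> k + \<eta> j) * (b - a)"
      using \<eta>_pos[of j] by (intro mult_right_mono) auto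
    with * have "(norm (u j - u k))\<^sup>2 \<le> b - a"
      using \<eta>_pos[of k] \<eta>_pos[of j] by (smt (verit) mult_le_cancel_left_pos)
    then show ?thesis by (simp add: a_def b_def)
  qed
  have inc: "incseq (\<lambda>n. norm (u n))"
  proof (rule incseq_SucI)
    fix n
    have "(norm (u n))\<^sup>2 \<le> (norm (u (Suc n)))\<^sup>2"
      using dist_le[of n "Suc n"] zero_le_power2[of "norm (u (Suc n) - u n)"] by linarith
    then show "norm (u n) \<le> norm (u (Suc n))"
      by (simp add: power2_le_iff_abs_le)
  qed
  have "\<not> bdd_above (range (\<lambda>n. norm (u n)))"
  proof
    assume bdd: "bdd_above (range (\<lambda>n. norm (u n)))"
    then have "convergent (\<lambda>n. norm (u n))"
      using LIMSEQ_incseq_SUP[OF bdd inc] convergent_def by blast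
    then have "convergent (\<lambda>n. (norm (u n))\<^sup>2)"
      unfolding convergent_def by (fast intro: tendsto_power)
    then have cau: "Cauchy (\<lambda>n. (norm (u n))\<^sup>2)"
      by (rule convergent_Cauchy)
    have "Cauchy u"
    proof (rule metric_CauchyI)
      fix e :: real
      assume e: "0 < e"
      then obtain K where K: "\<And>m n. K \<le> m \<Longrightarrow> K \<le> n \<Longrightarrow>
          dist ((norm (u m))\<^sup>2) ((norm (u n))\<^sup>2) < e\<^sup>2"
        using metric_CauchyD[OF cau, of "e\<^sup>2"] by auto
      have lt: "dist (u m) (u n) < e" if "K \<le> m" "m < n" for m n
      proof -
        have "(norm (u n - u m))\<^sup>2 < e\<^sup>2"
          using dist_le[OF that(2)] K[of m n] that unfolding dist_real_def by linarith
        then show ?thesis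
          using e by (simp add: dist_norm norm_minus_commute power_less_imp_less_base)
      qed
      show "\<exists>K. \<forall>m\<ge>K. \<forall>n\<ge>K. dist (u m) (u n) < e"
      proof (intro exI allI impI)
        fix m n
        assume "K \<le> m" "K \<le> n"
        then show "dist (u m) (u n) < e"
          using lt[of m n] lt[of n m] e by (cases m n rule: linorder_cases) (simp_all add: dist_commute)
      qed
    qed
    then obtain x where x: "u \<longlonglongrightarrow> x"
      using Cauchy_convergent_iff convergent_def by blast
    \<comment> \<open>T is continuous and \<eta> tends to 0, so the limit would be a fixed
      point.\<close>
    have "(\<lambda>n. norm (T (u n) - T x)) \<longlonglongrightarrow> 0"
      by (rule Lim_null_comparison[OF _ tendsto_norm_zero[OF LIM_zero[OF x]]])
        (use nonexp in auto)
    then have "(\<lambda>n. T (u n)) \<longlonglongrightarrow> T x"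
      by (simp add: LIM_zero_iff tendsto_norm_zero_iff)
    moreover have "(\<lambda>n. (1 + \<eta> n) *\<^sub>R u n) \<longlonglongrightarrow> (1 + 0) *\<^sub>R x"
      unfolding \<eta>_def by (intro tendsto_intros x LIMSEQ_Suc[OF lim_1_over_n])
    ultimately have "T x = x"
      unfolding u by (simp add: LIMSEQ_unique)
    then show False using no_fix by blast
  qed
  then have "filterlim (\<lambda>n. norm (u n)) at_top sequentially"
    using inc unfolding filterlim_at_top eventually_sequentially bdd_above_def incseq_def
    by (auto simp: not_le) (meson less_imp_le order_trans)
  with u show thesis
    unfolding \<eta>_def by (rule that)
qed

section \<open>Self-adjoint operators with a spectral gap\<close>

lemma scaleC_of_real: "complex_of_real r *\<^sub>C x = r *\<^sub>R x"
  by (simp add: scaleR_scaleC)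

lemma self_adjointD:
  assumes "self_adjoint D L"
  shows self_adjoint_mem_add: "u \<in> D \<Longrightarrow> v \<in> D \<Longrightarrow> u + v \<in> D"
    and self_adjoint_mem_scaleR: "u \<in> D \<Longrightarrow> r *\<^sub>R u \<in> D"
    and self_adjoint_add: "u \<in> D \<Longrightarrow> v \<in> D \<Longrightarrow> L (u + v) = L u + L v"
    and self_adjoint_scaleR: "u \<in> D \<Longrightarrow> L (r *\<^sub>R u) = r *\<^sub>R L u"
    and self_adjoint_dense: "closure D = UNIV"
proof -
  have D: "complex_vector.subspace D"
    and L: "\<And>u v. u \<in> D \<Longrightarrow> v \<in> D \<Longrightarrow> L (u + v) = L u + L v"
    "\<And>c u. u \<in> D \<Longrightarrow> L (c *\<^sub>C u) = c *\<^sub>C L u"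
    and dense: "closure D = UNIV"
    using assms unfolding self_adjoint_def linear_operator_def densely_defined_def by blast+
  show "u \<in> D \<Longrightarrow> v \<in> D \<Longrightarrow> u + v \<in> D"
    by (rule complex_vector.subspace_add[OF D])
  show "u \<in> D \<Longrightarrow> r *\<^sub>R u \<in> D"
    unfolding scaleR_scaleC by (rule complex_vector.subspace_scale[OF D])
  show "u \<in> D \<Longrightarrow> v \<in> D \<Longrightarrow> L (u + v) = L u + L v"
    by (rule L(1))
  show "u \<in> D \<Longrightarrow> L (r *\<^sub>R u) = r *\<^sub>R L u"
    unfolding scaleR_scaleC by (rule L(2))
  show "closure D = UNIV"
    by (rule dense)
qed

text \<open>\<open>adjoint_op\<close> is a definite description and yields its defining identity
  only once uniqueness is known: the difference of two candidates is orthogonal to the dense set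
  D.\<close>

lemma ex1_adjoint:
  assumes "closure D = UNIV" and "v \<in> adjoint_dom D L"
  shows "\<exists>!w. \<forall>u\<in>D. cinner (L u) v = cinner u w"
proof -
  obtain w where w: "\<forall>u\<in>D. cinner (L u) v = cinner u w"
    using assms(2) unfolding adjoint_dom_def by blast
  show ?thesis
  proof (rule ex1I[of _ w])
    fix w' assume w': "\<forall>u\<in>D. cinner (L u) v = cinner u w'"
    have "rinner u (w' - w) = 0" if "u \<in> D" for u
      using w w' that by (simp add: rinner.diff_right) (simp add: rinner_def)
    then have "w' - w = 0"
      by (rule eq_zero_if_orthogonal_dense[OF assms(1)])
    then show "w' = w" by simp
  qed (rule w)
qed

lemma self_adjoint_symmetric:
  assumes "self_adjoint D L" and "u \<in> D" and "v \<in> D"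
  shows "cinner (L u) v = cinner u (L v)"
proof -
  have "v \<in> adjoint_dom D L" and "adjoint_op D L v = L v"
    using assms unfolding self_adjoint_def by auto
  moreover have "\<forall>u\<in>D. cinner (L u) v = cinner u (adjoint_op D L v)"
    unfolding adjoint_op_def
    by (rule theI'[OF ex1_adjoint[OF self_adjoint_dense[OF assms(1)] calculation(1)]])
  ultimately show ?thesis
    using assms(2) by simp
qed

lemma self_adjoint_rinner:
  assumes "self_adjoint D L" and "u \<in> D" and "v \<in> D"
  shows "rinner (L u) v = rinner u (L v)"
  using self_adjoint_symmetric[OF assms] by (simp add: rinner_def)

text \<open>The zero vector witnesses that v is in the adjoint domain, which self-adjointness
  identifies with D. This serves for weak limits, not known beforehand to lie in D.\<close>

lemma self_adjoint_kernelI: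
  assumes sa: "self_adjoint D L" and orth: "\<And>u. u \<in> D \<Longrightarrow> cinner (L u) v = 0"
  shows "v \<in> op_kernel D L"
proof -
  have "v \<in> adjoint_dom D L"
    unfolding adjoint_dom_def using orth by (auto intro!: exI[of _ 0] simp: cinner_zero_right)
  then have v: "v \<in> D"
    using sa unfolding self_adjoint_def by auto
  have "L v = 0"
    by (rule eq_zero_if_orthogonal_dense[OF self_adjoint_dense[OF sa]])
      (use self_adjoint_symmetric[OF sa _ v] orth in \<open>auto simp: rinner_def\<close>)
  with v show ?thesis by (simp add: op_kernel_def)
qed

lemma resolvent_setE:
  assumes "complex_of_real z \<in> resolvent_set D L"
  obtains A where "bounded_linear A" and "\<And>y. A y \<in> D"
    and "\<And>y. L (A y) = y + z *\<^sub>R A y" and "\<And>u. u \<in> D \<Longrightarrow> A (L u - z *\<^sub>R u) = u"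
proof -
  define F where "F u = L u - z *\<^sub>R u" for u
  have "F = (\<lambda>u. L u - complex_of_real z *\<^sub>C u)"
    by (simp add: F_def scaleC_of_real fun_eq_iff)
  then have F: "bij_betw F D UNIV" "bounded_linear (inv_into D F)"
    using assms unfolding resolvent_set_def by auto
  show thesis
  proof (rule that)
    show "bounded_linear (inv_into D F)" by fact
    show "inv_into D F y \<in> D" for y
      using F(1) by (simp add: bij_betw_def inv_into_into)
    have "F (inv_into D F y) = y" for y
      using F(1) by (simp add: bij_betw_def f_inv_into_f)
    then show "L (inv_into D F y) = y + z *\<^sub>R inv_into D F y" for y
      unfolding F_def by (simp add: algebra_simps)
    show "inv_into D F (L u - z *\<^sub>R u) = u" if "u \<in> D" for u
      using inv_into_f_f[of F D u] F(1) that by (simp add: bij_betw_def F_def)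
  qed
qed

text \<open>
  Let A be the inverse of \<open>L - c\<close>, where c is the midpoint of the gap, and \<open>m = \<parallel>A\<parallel>\<close>.  The norm is
  attained at the spectrum: \<open>\<parallel>x - A\<^sup>2 x / m\<^sup>2\<parallel>\<^sup>2 \<le> \<parallel>x\<parallel>\<^sup>2 - \<parallel>A x\<parallel>\<^sup>2 / m\<^sup>2\<close>, hence \<open>m - A\<close> and \<open>m + A\<close>
  are not both bounded below.  So \<open>c + 1/m\<close> or \<open>c - 1/m\<close> is in the spectrum of L,
  which forces \<open>m \<le> 2/d\<close>.
\<close>

lemma spectral_gap_inequality:
  assumes sa: "self_adjoint D L" and d: "d > 0"
    and gap: "complex_of_real ` {-d<..<0} \<subseteq> resolvent_set D L" and u: "u \<in> D"
  shows "0 \<le> (norm (L u))\<^sup>2 + d * rinner (L u) u"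
proof -
  define c where "c = - d / 2"
  have in_gap: "complex_of_real z \<in> resolvent_set D L" if "-d < z" "z < 0" for z
    using gap that by auto
  obtain A where A: "bounded_linear A" and AD: "\<And>y. A y \<in> D"
    and LA: "\<And>y. L (A y) = y + c *\<^sub>R A y"
    and AL: "\<And>u. u \<in> D \<Longrightarrow> A (L u - c *\<^sub>R u) = u"
    using resolvent_setE[OF in_gap[of c]] d by (auto simp: c_def)
  interpret A: bounded_linear A by (fact A)
  define m where "m = onorm A"
  have m_bound: "norm (A x) \<le> m * norm x" for x
    unfolding m_def by (rule onorm[OF A])
  have sym: "rinner (A x) y = rinner x (A y)" for x y
    using self_adjoint_rinner[OF sa AD[of x] AD[of y]] unfolding LA
    by (simp add: rinner_add_left rinner_add_right rinner_scaleR_left rinner_scaleR_right)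
  \<comment> \<open>c + s stays in the gap and x - s A x = (L - (c + s)) A x, so the resolvent at c
    + s recovers A x, and with it x.\<close>
  have below: "\<exists>K\<ge>1. \<forall>x. norm x \<le> K * norm (x - s *\<^sub>R A x)" if s: "\<bar>s\<bar> < d / 2" for s
  proof -
    have "complex_of_real (c + s) \<in> resolvent_set D L"
      using s by (intro in_gap) (auto simp: c_def)
    then obtain R where R: "bounded_linear R" "\<And>u. u \<in> D \<Longrightarrow> R (L u - (c + s) *\<^sub>R u) = u"
      by (rule resolvent_setE) blast
    obtain k where k: "k > 0" "\<And>x. norm (R x) \<le> norm x * k"
      using bounded_linear.pos_bounded[OF R(1)] by blast
    have "norm x \<le> (1 + \<bar>s\<bar> * k) * norm (x - s *\<^sub>R A x)" for x
    proof -
      have "R (x - s *\<^sub>R A x) = A x"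
        using R(2)[OF AD[of x]] by (simp add: LA scaleR_add_left)
      then have "norm (A x) \<le> norm (x - s *\<^sub>R A x) * k"
        using k(2) by metis
      then have "\<bar>s\<bar> * norm (A x) \<le> \<bar>s\<bar> * (norm (x - s *\<^sub>R A x) * k)"
        by (rule mult_left_mono) simp
      moreover have "norm x \<le> norm (x - s *\<^sub>R A x) + norm (s *\<^sub>R A x)"
        by (metis diff_add_cancel norm_triangle_ineq)
      ultimately show ?thesis by (simp add: algebra_simps)
    qed
    moreover have "1 + \<bar>s\<bar> * k \<ge> 1" using k(1) by simp
    ultimately show ?thesis by blast
  qed
  have "m \<le> 2 / d"
  proof (rule ccontr)
    assume "\<not> m \<le> 2 / d"
    then have md: "2 / d < m" by simp
    have m: "0 < m"
      by (rule less_trans[OF _ md]) (use d in simp)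
    define s where "s = 1 / m"
    have s: "0 < s" "s < d / 2"
      using md m d by (simp_all add: s_def field_simps)
    obtain K1 where K1: "K1 \<ge> 1" "\<And>x. norm x \<le> K1 * norm (x - s *\<^sub>R A x)"
      using below[of s] s by auto
    obtain K2 where K2: "K2 \<ge> 1" "\<And>x. norm x \<le> K2 * norm (x + s *\<^sub>R A x)"
      using below[of "-s"] s by auto
    define K where "K = K1 * K2"
    have K: "K \<ge> 1"
      using mult_mono[OF K1(1) K2(1)] K1(1) by (simp add: K_def)
    have nonneg: "0 \<le> m * sqrt (1 - 1 / K\<^sup>2)"
      using K m by simp
    have "norm (A x) \<le> m * sqrt (1 - 1 / K\<^sup>2) * norm x" for x
    proof -
      \<comment> \<open>(1 + s A)(1 - s A) = 1 - s^2 A^2, so the lower bounds for both signs combine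
        with constant K1 K2.\<close>
      define y where "y = x - s *\<^sub>R A x"
      have "norm x \<le> K1 * norm y"
        using K1(2) by (simp add: y_def)
      also have "\<dots> \<le> K1 * (K2 * norm (y + s *\<^sub>R A y))"
        using K1(1) K2(2)[of y] by (intro mult_left_mono) auto
      also have "y + s *\<^sub>R A y = x - s\<^sup>2 *\<^sub>R A (A x)"
        by (simp add: y_def A.diff A.scaleR power2_eq_square algebra_simps)
      finally have "norm x \<le> K * norm (x - s\<^sup>2 *\<^sub>R A (A x))"
        by (simp add: K_def)
      then have "(norm x)\<^sup>2 \<le> K\<^sup>2 * (norm (x - s\<^sup>2 *\<^sub>R A (A x)))\<^sup>2"
        by (metis norm_ge_zero power_mono power_mult_distrib)
      also have "\<dots> \<le> K\<^sup>2 * ((norm x)\<^sup>2 - s\<^sup>2 * (norm (A x))\<^sup>2)"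
      proof (rule mult_left_mono)
        \<comment> \<open>Since s m = 1, the last term of the expanded square is at most s^2 |A
          x|^2, half of the cross term.\<close>
        have "(s\<^sup>2 * norm (A (A x)))\<^sup>2 \<le> (s\<^sup>2 * (m * norm (A x)))\<^sup>2"
          using m_bound[of "A x"] by (intro power_mono mult_left_mono) auto
        also have "\<dots> = s\<^sup>2 * (norm (A x))\<^sup>2"
          using m by (simp add: s_def power_mult_distrib power_divide field_simps)
        finally show "(norm (x - s\<^sup>2 *\<^sub>R A (A x)))\<^sup>2 \<le> (norm x)\<^sup>2 - s\<^sup>2 * (norm (A x))\<^sup>2"
          by (simp add: norm_diff_sq rinner_scaleR_right sym[symmetric] rinner_self)
      qed simp
      finally have "(norm x)\<^sup>2 \<le> K\<^sup>2 * ((norm x)\<^sup>2 - s\<^sup>2 * (norm (A x))\<^sup>2)" .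
      then have "(norm (A x))\<^sup>2 \<le> m\<^sup>2 * (1 - 1 / K\<^sup>2) * (norm x)\<^sup>2"
        using K m by (simp add: s_def field_simps)
      also have "\<dots> = (m * sqrt (1 - 1 / K\<^sup>2) * norm x)\<^sup>2"
        using K by (simp add: power_mult_distrib)
      finally have "(norm (A x))\<^sup>2 \<le> (m * sqrt (1 - 1 / K\<^sup>2) * norm x)\<^sup>2" .
      then show ?thesis
        by (rule power2_le_imp_le) (use nonneg in simp)
    qed
    then have "onorm A \<le> m * sqrt (1 - 1 / K\<^sup>2)"
      by (rule onorm_bound[OF nonneg])
    then have "m \<le> m * sqrt (1 - 1 / K\<^sup>2)"
      unfolding m_def[symmetric] .
    moreover have "sqrt (1 - 1 / K\<^sup>2) < 1"
      using K by simp
    ultimately show False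
      using m mult_strict_left_mono[of _ 1 m] by fastforce
  qed
  have "norm u \<le> m * norm (L u - c *\<^sub>R u)"
    using m_bound AL[OF u] by metis
  also have "\<dots> \<le> 2 / d * norm (L u - c *\<^sub>R u)"
    using \<open>m \<le> 2 / d\<close> by (rule mult_right_mono) simp
  finally have "d / 2 * norm u \<le> norm (L u - c *\<^sub>R u)"
    using d by (simp add: field_simps)
  \<comment> \<open>With c = -d/2 the terms d^2/4 |u|^2 cancel after expansion, and the cross term
    is the form times d.\<close>
  then have "(d / 2 * norm u)\<^sup>2 \<le> (norm (L u - c *\<^sub>R u))\<^sup>2"
    using d by (intro power_mono) auto
  then show ?thesis
    by (simp add: norm_add_sq c_def rinner_scaleR_right power_mult_distrib power_divide field_simps)
qed

lemma resolvent_below_inf_spectrum: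
  assumes "inf_spectrum D L \<ge> ereal a" and "x < a"
  shows "complex_of_real x \<in> resolvent_set D L"
proof (rule ccontr)
  assume "complex_of_real x \<notin> resolvent_set D L"
  then have "inf_spectrum D L \<le> ereal x"
    unfolding inf_spectrum_def spectrum_def by (intro INF_lower) auto
  with assms show False
    using order_trans by fastforce
qed

section \<open>Consequences of the gap combined with the lower bound of the spectrum\<close>

context
  fixes D :: "'a::complex_inner set" and L :: "'a \<Rightarrow> 'a" and \<delta> \<gamma> :: real
  assumes delta: "\<delta> > 0" and gamma: "\<gamma> \<ge> 0"
    and gap: "complex_of_real ` {-\<delta><..<0} \<subseteq> resolvent_set D L"
    and lower: "inf_spectrum D L \<ge> ereal (-\<gamma>)"
begin

lemma negative_in_resolvent:
  assumes "\<gamma> < \<delta>" and "x < 0"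
  shows "complex_of_real x \<in> resolvent_set D L"
proof (cases "x < - \<gamma>")
  case True
  then show ?thesis by (rule resolvent_below_inf_spectrum[OF lower])
next
  case False
  then show ?thesis using gap assms by auto
qed

text \<open>For \<gamma> < \<delta> the gap and the half-line below -\<gamma> cover the negative
  axis, so the gap inequality holds for every width d and the form is nonnegative. Otherwise width
  \<delta> gives the constant 1/\<delta> \<le> \<gamma>/\<delta>^2.\<close>

lemma form_lower_bound:
  assumes sa: "self_adjoint D L" and u: "u \<in> D"
  shows "- (\<gamma> / \<delta>\<^sup>2) * (norm (L u))\<^sup>2 \<le> rinner (L u) u"
proof (cases "\<gamma> < \<delta>")
  case True
  have le: "0 \<le> (norm (L u))\<^sup>2 + d * rinner (L u) u" if "d > 0" for d
    by (rule spectral_gap_inequality[OF sa that _ u]) (use True negative_in_resolvent in auto)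
  have "0 \<le> rinner (L u) u"
  proof (rule ccontr)
    assume neg: "\<not> 0 \<le> rinner (L u) u"
    \<comment> \<open>With this width the gap inequality would read 0 \<le> -1.\<close>
    define d where "d = ((norm (L u))\<^sup>2 + 1) / - rinner (L u) u"
    have "d > 0"
      unfolding d_def using neg by (intro divide_pos_pos) (auto intro: add_nonneg_pos)
    moreover have "d * rinner (L u) u = - (norm (L u))\<^sup>2 - 1"
      using neg by (simp add: d_def field_simps)
    ultimately show False
      using le[of d] by simp
  qed
  moreover have "0 \<le> \<gamma> / \<delta>\<^sup>2 * (norm (L u))\<^sup>2"
    using gamma by simp
  ultimately show ?thesis by simp
next
  case False
  have "- (\<gamma> / \<delta>\<^sup>2) * (norm (L u))\<^sup>2 \<le> - (1 / \<delta>) * (norm (L u))\<^sup>2"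
    using False delta by (intro mult_right_mono) (auto simp: power2_eq_square field_simps)
  also have "\<dots> \<le> rinner (L u) u"
    using spectral_gap_inequality[OF sa delta gap u] delta by (simp add: field_simps)
  finally show ?thesis .
qed

text \<open>Makes L + \<mu> invertible. If \<gamma> \<ge> \<delta>, then \<alpha> \<delta>^2 >
  \<gamma> \<ge> \<delta> gives 1/\<alpha> < \<delta>, so the point is in the gap.\<close>

lemma resolvent_point:
  assumes "\<alpha> > \<gamma> / \<delta>\<^sup>2"
  shows "complex_of_real (- (1 / (2 * \<alpha>))) \<in> resolvent_set D L"
proof -
  have \<alpha>: "\<alpha> > 0"
    using assms gamma delta by (smt (verit) divide_nonneg_nonneg zero_le_power2)
  show ?thesis
  proof (cases "\<gamma> < \<delta>")
    case True
    then show ?thesis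
      by (rule negative_in_resolvent) (use \<alpha> in simp)
  next
    case False
    have "\<delta> \<le> \<gamma>" using False by simp
    also have "\<gamma> < \<alpha> * \<delta>\<^sup>2"
      using assms delta by (simp add: field_simps)
    finally have "1 < \<alpha> * \<delta>"
      using delta by (simp add: power2_eq_square)
    then have "1 / (2 * \<alpha>) < \<delta>"
      using \<alpha> by (simp add: field_simps)
    then have "- (1 / (2 * \<alpha>)) \<in> {-\<delta><..<0}"
      using \<alpha> by simp
    then show ?thesis using gap by blast
  qed
qed

end

section \<open>The approximate equations\<close>

text \<open>As 2 \<mu> \<alpha> = 1, cocoercivity reads |w|^2 \<le> 2 \<mu>
  \<open>rinner w z\<close>, so the cross term of the expanded square absorbs |w|^2.\<close>

lemma cocoercive_shift_lipschitz:
  fixes N :: "'a::complex_inner \<Rightarrow> 'a"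
  assumes \<alpha>: "\<alpha> > 0"
    and coc: "\<And>x y. \<alpha> * (norm (N x - N y))\<^sup>2 \<le> rinner (N x - N y) (x - y)"
  defines "\<mu> \<equiv> 1 / (2 * \<alpha>)"
  shows "norm ((\<mu> *\<^sub>R x - N x) - (\<mu> *\<^sub>R y - N y)) \<le> \<mu> * norm (x - y)"
proof -
  define w z where "w = N x - N y" and "z = x - y"
  have \<mu>: "\<mu> > 0" "2 * \<mu> * \<alpha> = 1"
    using \<alpha> by (simp_all add: \<mu>_def)
  have "2 * \<mu> * (\<alpha> * (norm w)\<^sup>2) \<le> 2 * \<mu> * rinner w z"
    unfolding w_def z_def using \<mu>(1) by (intro mult_left_mono coc) simp
  then have "(norm w)\<^sup>2 \<le> 2 * \<mu> * rinner w z"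
    using \<mu>(2) by (simp add: mult.assoc[symmetric])
  then have "(norm (\<mu> *\<^sub>R z - w))\<^sup>2 \<le> (\<mu> * norm z)\<^sup>2"
    unfolding norm_diff_sq by (simp add: rinner_scaleR_left rinner_commute[of z] power_mult_distrib)
  then have "norm (\<mu> *\<^sub>R z - w) \<le> \<mu> * norm z"
    by (rule power2_le_imp_le) (use \<mu> in simp)
  then show ?thesis
    by (simp add: w_def z_def algebra_simps)
qed

text \<open>In the expanded square the form costs at most 2 \<mu> \<beta> |L w|^2, which |L w|^2
  covers. The resulting factor 1/\<mu> of the inverse cancels the Lipschitz constant \<mu> of the
  nonlinear part.\<close>

lemma shifted_resolvent_bound:
  assumes \<mu>: "\<mu> > 0" "2 * \<mu> * \<beta> \<le> 1"
    and form: "- \<beta> * (norm (L w))\<^sup>2 \<le> rinner (L w) w"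
  shows "\<mu> * norm w \<le> norm (L w + \<mu> *\<^sub>R w)"
proof -
  have "- (2 * \<mu> * \<beta> * (norm (L w))\<^sup>2) = 2 * \<mu> * (- \<beta> * (norm (L w))\<^sup>2)"
    by simp
  also have "\<dots> \<le> 2 * \<mu> * rinner (L w) w"
    by (intro mult_left_mono form) (use \<mu> in simp)
  finally have "- (2 * \<mu> * \<beta> * (norm (L w))\<^sup>2) \<le> 2 * \<mu> * rinner (L w) w" .
  moreover have "2 * \<mu> * \<beta> * (norm (L w))\<^sup>2 \<le> 1 * (norm (L w))\<^sup>2"
    by (intro mult_right_mono \<mu>) simp
  moreover have "(norm (L w + \<mu> *\<^sub>R w))\<^sup>2
      = (norm (L w))\<^sup>2 + 2 * \<mu> * rinner (L w) w + (\<mu> * norm w)\<^sup>2"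
    by (simp add: norm_add_sq rinner_scaleR_right power_mult_distrib)
  ultimately have "(\<mu> * norm w)\<^sup>2 \<le> (norm (L w + \<mu> *\<^sub>R w))\<^sup>2"
    by linarith
  then show ?thesis
    by (rule power2_le_imp_le) simp
qed

lemma approximate_solutions:
  fixes D :: "'a::complex_hilbert_space set" and L N :: "'a \<Rightarrow> 'a"
  assumes sa: "self_adjoint D L"
    and \<alpha>: "\<alpha> > 0" and \<beta>: "\<beta> \<le> \<alpha>"
    and res: "complex_of_real (- (1 / (2 * \<alpha>))) \<in> resolvent_set D L"
    and form: "\<And>u. u \<in> D \<Longrightarrow> - \<beta> * (norm (L u))\<^sup>2 \<le> rinner (L u) u"
    and coc: "\<And>x y. \<alpha> * (norm (N x - N y))\<^sup>2 \<le> rinner (N x - N y) (x - y)"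
    and no_sol: "\<And>u. u \<in> D \<Longrightarrow> L u + N u \<noteq> h"
  obtains u where "\<And>n. u n \<in> D"
    and "\<And>n. (1 + 1 / real (Suc n)) *\<^sub>R L (u n) + (1 / real (Suc n) * (1 / (2 * \<alpha>))) *\<^sub>R u n
           + N (u n) = h"
    and "filterlim (\<lambda>n. norm (u n)) at_top sequentially"
proof -
  define \<mu> where "\<mu> = 1 / (2 * \<alpha>)"
  have \<mu>: "\<mu> > 0" "2 * \<mu> * \<beta> \<le> 1"
    using \<alpha> \<beta> by (simp_all add: \<mu>_def field_simps)
  obtain R where R: "bounded_linear R" "\<And>y. R y \<in> D" "\<And>y. L (R y) = y + (- \<mu>) *\<^sub>R R y"
    by (rule resolvent_setE[OF res[folded \<mu>_def]]) blast
  interpret R: bounded_linear R by (fact R)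
  define T where "T x = R (h + (\<mu> *\<^sub>R x - N x))" for x
  have R_le: "\<mu> * norm (R y) \<le> norm y" for y
    using shifted_resolvent_bound[where L = L, OF \<mu> form[OF R(2)], of y] by (simp add: R(3))
  have nonexp: "norm (T x - T y) \<le> norm (x - y)" for x y
  proof -
    have "T x - T y = R ((\<mu> *\<^sub>R x - N x) - (\<mu> *\<^sub>R y - N y))"
      by (simp add: T_def flip: R.diff)
    then have "\<mu> * norm (T x - T y) \<le> norm ((\<mu> *\<^sub>R x - N x) - (\<mu> *\<^sub>R y - N y))"
      using R_le by simp
    also have "\<dots> \<le> \<mu> * norm (x - y)"
      unfolding \<mu>_def by (rule cocoercive_shift_lipschitz[OF \<alpha> coc])
    finally show ?thesis using \<mu> by simp
  qed
  \<comment> \<open>Applying L + \<mu> to T x = (1 + \<eta>) x leaves the surplus \<eta> \<mu> x.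
    For \<eta> = 0 this is the original equation, so T has no fixed point.\<close>
  have eigen: "x \<in> D \<and> (1 + \<eta>) *\<^sub>R L x + (\<eta> * \<mu>) *\<^sub>R x + N x = h"
    if x: "T x = (1 + \<eta>) *\<^sub>R x" and \<eta>: "\<eta> \<ge> 0" for x \<eta>
  proof -
    have x_eq: "x = (1 / (1 + \<eta>)) *\<^sub>R T x"
      using x \<eta> by simp
    have xD: "x \<in> D"
      by (subst x_eq, unfold T_def) (intro self_adjoint_mem_scaleR[OF sa] R)
    have "(1 + \<eta>) *\<^sub>R L x = L (T x)"
      unfolding x by (rule self_adjoint_scaleR[OF sa xD, symmetric])
    also have "\<dots> = h + (\<mu> *\<^sub>R x - N x) - \<mu> *\<^sub>R T x"
      by (simp add: T_def R(3))
    finally show ?thesis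
      using xD by (simp add: x algebra_simps)
  qed
  have "T x \<noteq> x" for x
    using eigen[of x 0] no_sol[of x] by auto
  from nonexpansive_no_fixpoint[OF nonexp this]
  obtain u where u: "\<And>n. T (u n) = (1 + 1 / real (Suc n)) *\<^sub>R u n"
    and lim: "filterlim (\<lambda>n. norm (u n)) at_top sequentially"
    by blast
  have "u n \<in> D \<and> (1 + 1 / real (Suc n)) *\<^sub>R L (u n) + (1 / real (Suc n) * \<mu>) *\<^sub>R u n + N (u n) = h"
    for n
    by (rule eigen[OF u]) simp
  then show thesis
    using that[OF _ _ lim] unfolding \<mu>_def by blast
qed

text \<open>
  In the approximate equation L is scaled by \<open>1 + \<eta>\<close>; this extra factor exactly absorbs the term
  \<open>\<eta>\<mu>u\<close>, so that the estimate does not depend on \<open>\<eta>\<close>.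
\<close>

lemma approximate_solution_estimate:
  fixes L N :: "'a::complex_inner \<Rightarrow> 'a"
  assumes eq: "(1 + \<eta>) *\<^sub>R L u + (\<eta> * \<mu>) *\<^sub>R u + N u = h"
    and \<eta>: "\<eta> \<ge> 0" and \<mu>: "\<mu> \<ge> 0" and \<beta>: "\<beta> \<ge> 0" "2 * \<mu> * \<beta> \<le> 1"
    and form: "- \<beta> * (norm (L u))\<^sup>2 \<le> rinner (L u) u"
  shows "rinner (N u) u \<le> rinner h u + \<beta> * (norm (h - N u))\<^sup>2"
proof -
  define b where "b = (1 + \<eta>) * rinner (L u) u"
  define e where "e = \<eta> * \<mu>"
  have e: "e \<ge> 0" using \<eta> \<mu> by (simp add: e_def)
  define y where "y = h - N u"
  have y: "y = (1 + \<eta>) *\<^sub>R L u + e *\<^sub>R u"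
    using eq by (simp add: y_def e_def algebra_simps)
  have yu: "rinner y u = b + e * (norm u)\<^sup>2"
    by (simp add: y b_def rinner_add_left rinner_scaleR_left rinner_self)
  have "((1 + \<eta>) * norm (L u))\<^sup>2 = (norm ((1 + \<eta>) *\<^sub>R L u))\<^sup>2"
    using \<eta> by simp
  also have "\<dots> = (norm (y - e *\<^sub>R u))\<^sup>2"
    by (simp add: y)
  also have "\<dots> = (norm y)\<^sup>2 - 2 * e * b - (e * norm u)\<^sup>2"
    unfolding norm_diff_sq rinner_scaleR_right yu norm_scaleR power_mult_distrib
    by (simp add: power2_eq_square algebra_simps)
  \<comment> \<open>Only -(e |u|)^2 is dropped; the term -2 e b is what the factor 1 + \<eta> has to
    absorb.\<close>
  finally have Lu: "((1 + \<eta>) * norm (L u))\<^sup>2 \<le> (norm y)\<^sup>2 - 2 * e * b"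
    by simp
  have "(1 + \<eta>)\<^sup>2 * (- \<beta> * (norm (L u))\<^sup>2) \<le> (1 + \<eta>)\<^sup>2 * rinner (L u) u"
    by (intro mult_left_mono form) simp
  then have "- \<beta> * ((1 + \<eta>) * norm (L u))\<^sup>2 \<le> (1 + \<eta>) * b"
    by (simp add: b_def power_mult_distrib power2_eq_square algebra_simps)
  moreover have "\<beta> * ((1 + \<eta>) * norm (L u))\<^sup>2 \<le> \<beta> * ((norm y)\<^sup>2 - 2 * e * b)"
    by (intro mult_left_mono Lu \<beta>)
  ultimately have *: "- \<beta> * (norm y)\<^sup>2 \<le> (1 + \<eta> * (1 - 2 * \<mu> * \<beta>)) * b"
    by (simp add: e_def algebra_simps)
  have "- \<beta> * (norm y)\<^sup>2 \<le> b"
  \<comment> \<open>Only negative b matters. There the factor of b, at least 1 because 2 \<mu>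
    \<beta> \<le> 1, may be replaced by 1.\<close>
  proof (cases "b \<ge> 0")
    case True
    have "0 \<le> \<beta> * (norm y)\<^sup>2" using \<beta>(1) by simp
    with True show ?thesis by simp
  next
    case False
    have "1 \<le> 1 + \<eta> * (1 - 2 * \<mu> * \<beta>)"
      using \<eta> \<beta>(2) by simp
    then have "(1 + \<eta> * (1 - 2 * \<mu> * \<beta>)) * b \<le> 1 * b"
      by (rule mult_right_mono_neg) (use False in simp)
    with * show ?thesis by simp
  qed
  moreover have "rinner y u = rinner h u - rinner (N u) u"
    by (simp add: y_def rinner.diff_left)
  moreover have "0 \<le> e * (norm u)\<^sup>2"
    using e by simp
  ultimately show ?thesis
    using yu by (simp add: y_def)
qed

section \<open>The a priori bound\<close>

text \<open>Cocoercivity against 0 bounds \<beta> |N u|^2 by \<beta>/\<alpha> times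
  \<open>rinner (N u) u\<close>; moved to the left, this yields the factor \<alpha>/(\<alpha> -
  \<beta>). The same estimate makes N u_n of lower order than |u_n|, so the equation divided by
  |u_n| sends L v_n to 0.\<close>

lemma unbounded_approximate_solutions_limit:
  fixes D :: "'a::complex_hilbert_space set" and L N :: "'a \<Rightarrow> 'a"
  assumes sep: "separable_space (euclidean :: 'a topology)"
    and sa: "self_adjoint D L"
    and \<beta>: "0 \<le> \<beta>" "\<beta> < \<alpha>"
    and form: "\<And>u. u \<in> D \<Longrightarrow> - \<beta> * (norm (L u))\<^sup>2 \<le> rinner (L u) u"
    and coc: "\<And>x y. \<alpha> * (norm (N x - N y))\<^sup>2 \<le> rinner (N x - N y) (x - y)"
    and N0: "N 0 = 0"
    and uD: "\<And>n. u n \<in> D"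
    and eq: "\<And>n. (1 + 1 / real (Suc n)) *\<^sub>R L (u n)
           + (1 / real (Suc n) * (1 / (2 * \<alpha>))) *\<^sub>R u n + N (u n) = h"
    and lim: "filterlim (\<lambda>n. norm (u n)) at_top sequentially"
  obtains r w where "strict_mono (r :: nat \<Rightarrow> nat)" and "w \<in> op_kernel D L" and "norm w \<le> 1"
    and "weakly_tendsto (\<lambda>n. (1 / norm (u (r n))) *\<^sub>R u (r n)) w"
    and "limsup (\<lambda>n. ereal (rinner (N (u (r n))) (u (r n)) / norm (u (r n))))
           \<le> ereal (\<alpha> / (\<alpha> - \<beta>) * rinner h w)"
proof -
  have \<alpha>: "\<alpha> > 0" using \<beta> by simp
  define \<mu> where "\<mu> = 1 / (2 * \<alpha>)"
  have \<mu>: "\<mu> > 0" "2 * \<mu> * \<beta> \<le> 1"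
    using \<alpha> \<beta> by (simp_all add: \<mu>_def field_simps)
  define \<eta> where "\<eta> n = 1 / real (Suc n)" for n
  have \<eta>: "\<eta> n \<ge> 0" for n by (simp add: \<eta>_def)
  have eq': "(1 + \<eta> n) *\<^sub>R L (u n) + (\<eta> n * \<mu>) *\<^sub>R u n + N (u n) = h" for n
    using eq[of n] by (simp add: \<eta>_def \<mu>_def)
  define t where "t n = norm (u n)" for n
  \<comment> \<open>If u n = 0, division by zero gives v n = 0, so \<open>v_le\<close> and
    \<open>vD\<close> hold for all n.\<close>
  define v where "v n = (1 / t n) *\<^sub>R u n" for n
  define x where "x n = norm (N (u n)) / t n" for n
  define p where "p n = rinner (N (u n)) (u n) / t n" for n
  have t0: "t n \<ge> 0" for n by (simp add: t_def)
  have v_le: "norm (v n) \<le> 1" for n by (simp add: v_def t_def)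
  have vD: "v n \<in> D" for n
    unfolding v_def by (intro self_adjoint_mem_scaleR[OF sa] uD)
  have N_le: "\<alpha> * (norm (N (u n)))\<^sup>2 \<le> rinner (N (u n)) (u n)" for n
    using coc[of "u n" 0] by (simp add: N0)
  \<comment> \<open>A rough linear bound, enough to keep the mixed term in \<open>main\<close>
    linear in t.\<close>
  have N_le': "\<alpha> * norm (N (u n)) \<le> t n" for n
  proof (cases "N (u n) = 0")
    case False
    have "\<alpha> * norm (N (u n)) * norm (N (u n)) \<le> t n * norm (N (u n))"
      using N_le[of n] abs_rinner_le[of "N (u n)" "u n"]
      by (simp add: t_def power2_eq_square mult_ac)
    then show ?thesis using False by simp
  qed (use t0 in simp)
  have main: "(1 - \<beta> / \<alpha>) * rinner (N (u n)) (u n)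
      \<le> rinner h (u n) + \<beta> * (norm h)\<^sup>2 + 2 * \<beta> * norm h * norm (N (u n))" for n
  proof -
    have "(norm (h - N (u n)))\<^sup>2 \<le> (norm h)\<^sup>2 + 2 * norm h * norm (N (u n)) + (norm (N (u n)))\<^sup>2"
      using abs_rinner_le[of h "N (u n)"] by (simp add: norm_diff_sq)
    also have "(norm (N (u n)))\<^sup>2 \<le> rinner (N (u n)) (u n) / \<alpha>"
      using N_le[of n] \<alpha> by (simp add: field_simps)
    finally have "\<beta> * (norm (h - N (u n)))\<^sup>2
        \<le> \<beta> * ((norm h)\<^sup>2 + 2 * norm h * norm (N (u n)) + rinner (N (u n)) (u n) / \<alpha>)"
      using \<beta>(1) by (intro mult_left_mono) auto
    with approximate_solution_estimate[where L = L and N = N, OF eq'[of n] \<eta> less_imp_le[OF \<mu>(1)]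
        \<beta>(1) \<mu>(2) form[OF uD]]
    show ?thesis by (simp add: algebra_simps)
  qed
  have t_pos: "eventually (\<lambda>n. t n > 0) sequentially"
    using lim unfolding filterlim_at_top_dense t_def by blast
  have inv_t: "(\<lambda>n. 1 / t n) \<longlonglongrightarrow> 0"
    using tendsto_inverse_0_at_top[OF lim] by (simp add: t_def divide_inverse)
  have x_lim: "x \<longlonglongrightarrow> 0"
  proof -
    \<comment> \<open>The bound from \<open>main\<close> is linear in t; divided by t^2 it is of
      order 1/t, so its root tends to 0.\<close>
    define C where "C n = (norm h * (1 / t n) + \<beta> * (norm h)\<^sup>2 * (1 / t n)\<^sup>2
        + 2 * \<beta> * norm h / \<alpha> * (1 / t n)) / (\<alpha> - \<beta>)" for n
    have "C \<longlonglongrightarrow> (norm h * 0 + \<beta> * (norm h)\<^sup>2 * 0\<^sup>2 + 2 * \<beta> * norm h / \<alpha> * 0) / (\<alpha> - \<beta>)"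
      unfolding C_def using \<beta> by (intro tendsto_intros inv_t) auto
    then have C: "(\<lambda>n. sqrt (C n)) \<longlonglongrightarrow> 0"
      using tendsto_real_sqrt[of C 0] by simp
    have "eventually (\<lambda>n. norm (x n) \<le> sqrt (C n)) sequentially"
      using t_pos
    proof eventually_elim
      case (elim n)
      have "(\<alpha> - \<beta>) * (norm (N (u n)))\<^sup>2 = (1 - \<beta> / \<alpha>) * (\<alpha> * (norm (N (u n)))\<^sup>2)"
        using \<alpha> by (simp add: field_simps)
      also have "\<dots> \<le> (1 - \<beta> / \<alpha>) * rinner (N (u n)) (u n)"
        using \<alpha> \<beta> by (intro mult_left_mono N_le) (simp add: field_simps)
      also have "\<dots> \<le> norm h * t n + \<beta> * (norm h)\<^sup>2 + 2 * \<beta> * norm h * norm (N (u n))"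
        using main[of n] abs_rinner_le[of h "u n"] by (simp add: t_def)
      also have "\<dots> \<le> norm h * t n + \<beta> * (norm h)\<^sup>2 + 2 * \<beta> * norm h * (t n / \<alpha>)"
        using N_le'[of n] \<alpha> \<beta>
        by (intro add_left_mono mult_left_mono) (auto simp: field_simps)
      also have "\<dots> = (norm h * (1 / t n) + \<beta> * (norm h)\<^sup>2 * (1 / t n)\<^sup>2
          + 2 * \<beta> * norm h / \<alpha> * (1 / t n)) * (t n)\<^sup>2"
        using elim \<alpha> by (simp add: field_simps power2_eq_square)
      also have "\<dots> = (\<alpha> - \<beta>) * (C n * (t n)\<^sup>2)"
        using \<beta> by (simp add: C_def)
      finally have "(norm (N (u n)))\<^sup>2 \<le> C n * (t n)\<^sup>2"
        using \<beta> by (simp only: mult_le_cancel_left_pos diff_gt_0_iff_gt)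
      then have "(x n)\<^sup>2 \<le> C n"
        using elim by (simp add: x_def power_divide divide_le_eq)
      then show ?case
        using real_le_rsqrt by (simp add: x_def t_def)
    qed
    then show ?thesis
      by (rule Lim_null_comparison[OF _ C])
  qed
  have Lv: "(\<lambda>n. L (v n)) \<longlonglongrightarrow> 0"
  proof (rule Lim_null_comparison)
    have "norm (L (v n)) \<le> norm h * (1 / t n) + x n + \<eta> n * \<mu>" for n
    proof -
      have "norm (L (v n)) \<le> (1 + \<eta> n) * norm (L (v n))"
        using mult_right_mono[of 1 "1 + \<eta> n" "norm (L (v n))"] \<eta> by simp
      also have "\<dots> = norm ((1 + \<eta> n) *\<^sub>R L (v n))"
        using \<eta>[of n] by simp
      also have "(1 + \<eta> n) *\<^sub>R L (v n) = (1 / t n) *\<^sub>R ((1 + \<eta> n) *\<^sub>R L (u n))"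
        unfolding v_def self_adjoint_scaleR[OF sa uD] by (simp add: mult.commute)
      also have "(1 + \<eta> n) *\<^sub>R L (u n) = h - N (u n) - (\<eta> n * \<mu>) *\<^sub>R u n"
        using eq'[of n] by (simp add: algebra_simps)
      also have "(1 / t n) *\<^sub>R \<dots> = (1 / t n) *\<^sub>R h - (1 / t n) *\<^sub>R N (u n) - (\<eta> n * \<mu>) *\<^sub>R v n"
        by (simp add: v_def scaleR_diff_right mult.commute)
      also have "norm \<dots> \<le> norm ((1 / t n) *\<^sub>R h) + norm ((1 / t n) *\<^sub>R N (u n))
          + norm ((\<eta> n * \<mu>) *\<^sub>R v n)"
        using norm_triangle_ineq4[of "(1 / t n) *\<^sub>R h - (1 / t n) *\<^sub>R N (u n)" "(\<eta> n * \<mu>) *\<^sub>R v n"]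
          norm_triangle_ineq4[of "(1 / t n) *\<^sub>R h" "(1 / t n) *\<^sub>R N (u n)"] by linarith
      also have "norm ((1 / t n) *\<^sub>R h) = norm h * (1 / t n)"
        using t0 by simp
      also have "norm ((1 / t n) *\<^sub>R N (u n)) = x n"
        using t0 by (simp add: x_def)
      also have "norm ((\<eta> n * \<mu>) *\<^sub>R v n) \<le> \<eta> n * \<mu> * 1"
        using \<eta>[of n] \<mu> v_le[of n] by (simp add: mult_left_le)
      finally show ?thesis by simp
    qed
    then show "\<forall>\<^sub>F n in sequentially. norm (L (v n)) \<le> norm h * (1 / t n) + x n + \<eta> n * \<mu>"
      by simp
    have "(\<lambda>n. norm h * (1 / t n) + x n + \<eta> n * \<mu>) \<longlonglongrightarrow> norm h * 0 + 0 + 0 * \<mu>"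
      unfolding \<eta>_def by (intro tendsto_intros inv_t x_lim LIMSEQ_Suc[OF lim_1_over_n])
    then show "(\<lambda>n. norm h * (1 / t n) + x n + \<eta> n * \<mu>) \<longlonglongrightarrow> 0" by simp
  qed
  obtain r w where r: "strict_mono r" and w: "weakly_tendsto (v \<circ> r) w"
    by (rule weakly_convergent_subsequence[OF sep v_le])
  have w_lim: "(\<lambda>n. rinner (v (r n)) y) \<longlonglongrightarrow> rinner w y" for y
    using w by (simp add: weakly_tendsto_iff_rinner)
  have "w \<in> op_kernel D L"
  proof (rule self_adjoint_kernelI[OF sa])
    fix y assume y: "y \<in> D"
    \<comment> \<open>Symmetry identifies the weak limit of v tested with L y and the strong limit
      of L v tested with y.\<close>
    have "(\<lambda>n. cinner ((v \<circ> r) n) (L y)) \<longlonglongrightarrow> cinner w (L y)"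
      using w unfolding weakly_tendsto_def by blast
    moreover have "cinner ((v \<circ> r) n) (L y) = cnj (cinner y (L (v (r n))))" for n
      using self_adjoint_symmetric[OF sa vD y] cinner_commute by (metis comp_apply)
    moreover have "(\<lambda>n. cnj (cinner y (L (v (r n))))) \<longlonglongrightarrow> cnj (cinner y 0)"
      using LIMSEQ_subseq_LIMSEQ[OF Lv r]
      by (intro tendsto_cnj tendsto_cinner_right) (simp add: o_def)
    ultimately have "cinner w (L y) = 0"
      using LIMSEQ_unique by (fastforce simp: cinner_zero_right)
    then show "cinner (L y) w = 0"
      using cinner_commute[of "L y" w] by simp
  qed
  moreover have "norm w \<le> 1"
  proof -
    \<comment> \<open>Weak lower semicontinuity of the norm, by testing the weak limit with w
      itself.\<close>
    have "rinner w w \<le> norm w"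
    proof (rule LIMSEQ_le_const2[OF w_lim])
      have "rinner (v (r n)) w \<le> norm w" for n
        using abs_rinner_le[of "v (r n)" w] mult_right_mono[OF v_le[of "r n"] norm_ge_zero[of w]]
        by linarith
      then show "\<exists>N. \<forall>n\<ge>N. rinner (v (r n)) w \<le> norm w" by blast
    qed
    then have "norm w * norm w \<le> 1 * norm w"
      by (simp add: rinner_self power2_eq_square)
    then show ?thesis
      by (cases "w = 0") (simp_all only: mult_le_cancel_right, auto)
  qed
  moreover have "weakly_tendsto (\<lambda>n. (1 / norm (u (r n))) *\<^sub>R u (r n)) w"
    using w by (simp add: o_def v_def t_def)
  moreover have "limsup (\<lambda>n. ereal (p (r n))) \<le> ereal (\<alpha> / (\<alpha> - \<beta>) * rinner h w)"
  proof -
    \<comment> \<open>Only the first term survives in the limit, by weak convergence; the others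
      carry 1/t or x.\<close>
    define q where "q n = \<alpha> / (\<alpha> - \<beta>) *
        (rinner (v n) h + \<beta> * (norm h)\<^sup>2 * (1 / t n) + 2 * \<beta> * norm h * x n)" for n
    have "p n \<le> q n" for n
    proof -
      have "(1 - \<beta> / \<alpha>) * rinner (N (u n)) (u n) * (1 / t n)
          \<le> (rinner h (u n) + \<beta> * (norm h)\<^sup>2 + 2 * \<beta> * norm h * norm (N (u n))) * (1 / t n)"
        by (intro mult_right_mono main) (use t0 in simp)
      then have *: "(1 - \<beta> / \<alpha>) * p n
          \<le> rinner (v n) h + \<beta> * (norm h)\<^sup>2 * (1 / t n) + 2 * \<beta> * norm h * x n"
        by (simp add: p_def x_def v_def rinner_scaleR_left rinner_commute[of "u n" h]
            distrib_right add_divide_distrib)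
      have "\<alpha> / (\<alpha> - \<beta>) * ((1 - \<beta> / \<alpha>) * p n) \<le> q n"
        unfolding q_def using \<alpha> \<beta> by (intro mult_left_mono *) simp
      moreover have "\<alpha> / (\<alpha> - \<beta>) * (1 - \<beta> / \<alpha>) = 1"
        using \<alpha> \<beta> by (simp add: field_simps)
      ultimately show ?thesis by (simp only: mult.assoc[symmetric] mult_1_left)
    qed
    then have "limsup (\<lambda>n. ereal (p (r n))) \<le> limsup (\<lambda>n. ereal (q (r n)))"
      by (intro Limsup_mono) simp
    also have "(\<lambda>n. q (r n)) \<longlonglongrightarrow> \<alpha> / (\<alpha> - \<beta>) *
        (rinner w h + \<beta> * (norm h)\<^sup>2 * 0 + 2 * \<beta> * norm h * 0)"
      unfolding q_def
      using LIMSEQ_subseq_LIMSEQ[OF inv_t r] LIMSEQ_subseq_LIMSEQ[OF x_lim r]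
      by (intro tendsto_intros w_lim) (simp_all add: o_def)
    then have "limsup (\<lambda>n. ereal (q (r n))) = ereal (\<alpha> / (\<alpha> - \<beta>) * rinner h w)"
      by (intro lim_imp_Limsup) (simp_all add: rinner_commute)
    finally show ?thesis .
  qed
  ultimately show thesis
    using that[OF r] by (simp add: p_def t_def)
qed

section \<open>Contradiction of the asymptotic bound with the growth and recession
  conditions\<close>

theorem theorem1:
  fixes D :: "'h::complex_hilbert_space set"
    and L N :: "'h \<Rightarrow> 'h"
    and h :: 'h
    and \<delta> \<gamma> \<alpha> :: real
  assumes separable: "separable_space (euclidean :: 'h topology)"
    and self_adjoint: "self_adjoint D L"
    and delta: "\<delta> > 0" and gamma: "\<gamma> \<ge> 0"
    and L1: "0 \<in> spectrum D L"
    and L2: "complex_of_real ` {-\<delta><..<0} \<subseteq> resolvent_set D L"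
    and L3: "inf_spectrum D L \<ge> ereal (-\<gamma>)"
    and h: "h \<noteq> 0"
    and N_bounded: "bounded_operator N"
    and N_demicontinuous: "demicontinuous N"
    and N_zero: "N 0 = 0"
    and alpha: "\<alpha> > \<gamma> / \<delta>\<^sup>2"
    and cocoercive:
      "\<And>u1 u2. Re (cinner (N u1 - N u2) (u1 - u2)) \<ge> \<alpha> * (norm (N u1 - N u2))\<^sup>2"
    and growth:
      "\<And>u :: nat \<Rightarrow> 'h. filterlim (\<lambda>k. norm (u k)) at_top sequentially \<Longrightarrow>
        limsup (\<lambda>k. ereal (Re (cinner (N (u k)) (u k)) / norm (u k)))
          > ereal (\<gamma> * norm h / (\<delta>\<^sup>2 * \<alpha> - \<gamma>))"
    and recession:
      "\<And>u. u \<in> op_kernel D L - {0} \<Longrightarrow>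
        recession_functional N u
          > ereal (\<gamma> * norm h / (\<delta>\<^sup>2 * \<alpha> - \<gamma>) + Re (cinner h u))"
  shows "\<exists>u\<in>D. L u + N u = h"
proof (rule ccontr)
  assume "\<not> (\<exists>u\<in>D. L u + N u = h)"
  then have no_sol: "\<And>u. u \<in> D \<Longrightarrow> L u + N u \<noteq> h" by blast
  define \<beta> where "\<beta> = \<gamma> / \<delta>\<^sup>2"
  have \<beta>: "0 \<le> \<beta>" "\<beta> < \<alpha>"
    using gamma alpha by (simp_all add: \<beta>_def)
  have \<alpha>: "\<alpha> > 0" using \<beta> by simp
  \<comment> \<open>The common threshold of both conditions; over \<delta>^2 its denominator becomes
    \<alpha> - \<beta>, as in the asymptotic bound.\<close>
  define c where "c = \<gamma> * norm h / (\<delta>\<^sup>2 * \<alpha> - \<gamma>)"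
  have c: "c = \<beta> / (\<alpha> - \<beta>) * norm h"
    using delta by (simp add: c_def \<beta>_def field_simps)
  have form: "\<And>u. u \<in> D \<Longrightarrow> - \<beta> * (norm (L u))\<^sup>2 \<le> rinner (L u) u"
    unfolding \<beta>_def by (rule form_lower_bound[OF delta gamma L2 L3 self_adjoint])
  have coc: "\<And>x y. \<alpha> * (norm (N x - N y))\<^sup>2 \<le> rinner (N x - N y) (x - y)"
    using cocoercive by (simp add: rinner_def)
  obtain u where u: "\<And>n. u n \<in> D"
    "\<And>n. (1 + 1 / real (Suc n)) *\<^sub>R L (u n) + (1 / real (Suc n) * (1 / (2 * \<alpha>))) *\<^sub>R u n
      + N (u n) = h"
    and lim: "filterlim (\<lambda>n. norm (u n)) at_top sequentially"
    using approximate_solutions[OF self_adjoint \<alpha> less_imp_le[OF \<beta>(2)]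
        resolvent_point[OF delta gamma L2 L3 alpha] form coc no_sol] by blast
  obtain r w where r: "strict_mono r" and wK: "w \<in> op_kernel D L" and w1: "norm w \<le> 1"
    and weak: "weakly_tendsto (\<lambda>n. (1 / norm (u (r n))) *\<^sub>R u (r n)) w"
    and ls: "limsup (\<lambda>n. ereal (rinner (N (u (r n))) (u (r n)) / norm (u (r n))))
        \<le> ereal (\<alpha> / (\<alpha> - \<beta>) * rinner h w)"
    by (rule unbounded_approximate_solutions_limit
        [OF separable self_adjoint \<beta> form coc N_zero u lim])
  have lim_r: "filterlim (\<lambda>n. norm (u (r n))) at_top sequentially"
    by (rule filterlim_compose[OF lim filterlim_subseq[OF r]])
  \<comment> \<open>After splitting off 1, the remaining factor \<beta>/(\<alpha> - \<beta>) meets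
    at most |h|, since |w| \<le> 1; their product is c.\<close>
  have "\<alpha> / (\<alpha> - \<beta>) * rinner h w = rinner h w + \<beta> / (\<alpha> - \<beta>) * rinner h w"
    using \<beta> by (simp add: field_simps)
  also have "\<dots> \<le> rinner h w + \<beta> / (\<alpha> - \<beta>) * norm h"
  proof -
    have "rinner h w \<le> norm h"
      using abs_rinner_le[of h w] mult_left_mono[OF w1 norm_ge_zero[of h]] by linarith
    then show ?thesis
      using \<beta> by (intro add_left_mono mult_left_mono) auto
  qed
  finally have le: "\<alpha> / (\<alpha> - \<beta>) * rinner h w \<le> c + rinner h w"
    by (simp add: c)
  show False
  proof (cases "w = 0")
    case True
    have "0 \<le> c" using \<beta> by (simp add: c)
    then have "ereal (\<alpha> / (\<alpha> - \<beta>) * rinner h w) \<le> ereal c"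
      by (simp add: True rinner.zero_right)
    with ls growth[OF lim_r] show False
      unfolding rinner_def c_def by (meson leD order_trans)
  next
    case False
    \<comment> \<open>The quotient is the expression in the recession functional for t = |u| and v =
      u/|u|, so these sequences compete in its infimum. If u = 0, both sides are 0.\<close>
    have pw: "rinner (N (u (r n))) (u (r n)) / norm (u (r n)) =
        Re (cinner (N (norm (u (r n)) *\<^sub>R ((1 / norm (u (r n))) *\<^sub>R u (r n))))
          ((1 / norm (u (r n))) *\<^sub>R u (r n)))" for n
      by (cases "u (r n) = 0") (simp_all add: rinner_scaleR_right flip: rinner_def, simp add: rinner.zero_right)
    have "recession_functional N w
        \<le> liminf (\<lambda>n. ereal (rinner (N (u (r n))) (u (r n)) / norm (u (r n))))"
      unfolding recession_functional_def pw using lim_r weak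
      by (intro Inf_lower CollectI exI[of _ "\<lambda>n. norm (u (r n))"]
          exI[of _ "\<lambda>n. (1 / norm (u (r n))) *\<^sub>R u (r n)"] conjI refl)
    also have "\<dots> \<le> limsup (\<lambda>n. ereal (rinner (N (u (r n))) (u (r n)) / norm (u (r n))))"
      by (rule Liminf_le_Limsup) simp
    also have "\<dots> \<le> ereal (\<alpha> / (\<alpha> - \<beta>) * rinner h w)"
      by (rule ls)
    also have "\<dots> \<le> ereal (c + rinner h w)"
      using le by simp
    also have "\<dots> < recession_functional N w"
      using recession[of w] wK False by (simp add: c_def rinner_def)
    finally show False by simp
  qed
qed

end
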